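(* Let $m_i=p_i/p_{i^*}$ for $i\in\mathcal{N}\setminus\{i^*\}$. Consider a file of size $F\in(k\Delta r_{i^*},(k+1)\Delta r_{i^*})$ for some $k\in\{0,1,2,\dots\}$. Then $$\frac{F}{F+\Delta\,\mathbf{1}_{\{\alpha_{i^*}>0\}}(1-p_{i^*})r_{i^*}}\ \le\ \frac{\mathbb{E}[T(\pi^*(F),F)]}{\mathbb{E}[T(i^*,F)]}\ \le\ \min_{i\in\mathcal{N}\setminus\{i^*\}}\left\{1,\ \frac{\dfrac{F}{\Delta r_i}+1-p_i-k\,m_i\,\dfrac{r_{i^*}p_{i^*}-r_ip_i}{r_ip_i}}{(k+1)(m_i-p_i)}\right\}.$$
   Context: Let $\mathcal{N}=\{1,\dots,N\}$, $N\ge 2$, be a finite set of channels, $\Delta>0$ a fixed slot duration, and for each $i\in\mathcal{N}$ let $r_i>0$ (rate) and $p_i\in(0,1]$ (availability probability). In each time slot $[k\Delta,(k+1)\Delta)$, $k=0,1,2,\dots$, channel $i$ is available with probability $p_i$, independently over slots and channels. A (deterministic) dynamic policy is a map $\pi:[0,\infty)\to\mathcal{N}$: if the remaining file size at the beginning of a slot is $s>0$, channel $i=\pi(s)$ is sensed. If it is unavailable (probability $1-p_i$), the slot of duration $\Delta$ is wasted and the remaining size stays $s$. If it is available (probability $p_i$), the remaining size becomes $\max\{0,s-\Delta r_i\}$ and the time spent is $\min\{\Delta,s/r_i\}$. The process ends when the remaining size is $0$. $T(\pi,F)$ is the total time spent until then, starting with remaining size $F$, and $\Pi(F)$ is the set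 of such policies for file size $F$. The dynamic optimal policy is $\pi^*(F)=\arg\min_{\pi\in\Pi(F)}\mathbb{E}[T(\pi,F)]$. For a channel $i$, $T(i,F)$ denotes the transfer time of the constant (static) policy $\pi\equiv i$. The max-throughput channel is $i^*=\arg\max_{k\in\mathcal{N}}r_kp_k$, assumed unique: $r_{i^*}p_{i^*}>r_kp_k$ for all $k\ne i^*$. It is assumed that $p_{i^*}<1$, so that $m_i>p_i$. Finally $\alpha_i=F/(\Delta r_i)-\lfloor F/(\Delta r_i)\rfloor$, and $\mathbf{1}_{\{\cdot\}}$ denotes the indicator. *)

theory Defs
  imports "HOL-Probability.Probability"
begin

text \<open>
  Throughout, \<open>X n i \<omega>\<close> says that channel \<open>i\<close> is available in slot \<open>n\<close>
  (the time interval from \<open>n * \<Delta>\<close> to \<open>(n + 1) * \<Delta>\<close>) in outcome \<open>\<omega>\<close>.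
\<close>

definition policies :: "nat \<Rightarrow> (real \<Rightarrow> nat) set" where
  "policies N = {0..} \<rightarrow> {1..N}"

primrec remaining_size ::
  "real \<Rightarrow> (nat \<Rightarrow> real) \<Rightarrow> (nat \<Rightarrow> nat \<Rightarrow> 'w \<Rightarrow> bool) \<Rightarrow> (real \<Rightarrow> nat) \<Rightarrow> real \<Rightarrow> 'w \<Rightarrow> nat \<Rightarrow> real"
where
  "remaining_size \<Delta> r X \<pi> F \<omega> 0 = F"
| "remaining_size \<Delta> r X \<pi> F \<omega> (Suc n) =
     (let s = remaining_size \<Delta> r X \<pi> F \<omega> n; i = \<pi> s
      in if s > 0 \<and> X n i \<omega> then max 0 (s - \<Delta> * r i) else s)"

definition slot_time ::
  "real \<Rightarrow> (nat \<Rightarrow> real) \<Rightarrow> (nat \<Rightarrow> nat \<Rightarrow> 'w \<Rightarrow> bool) \<Rightarrow> (real \<Rightarrow> nat) \<Rightarrow> real \<Rightarrow> 'w \<Rightarrow> nat \<Rightarrow> real"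
where
  "slot_time \<Delta> r X \<pi> F \<omega> n =
     (let s = remaining_size \<Delta> r X \<pi> F \<omega> n; i = \<pi> s
      in if s > 0 then (if X n i \<omega> then min \<Delta> (s / r i) else \<Delta>) else 0)"

text \<open>
  The transfer time takes values in the extended nonnegative reals, since it is infinite
  on outcomes in which the transfer never completes.
\<close>

definition transfer_time ::
  "real \<Rightarrow> (nat \<Rightarrow> real) \<Rightarrow> (nat \<Rightarrow> nat \<Rightarrow> 'w \<Rightarrow> bool) \<Rightarrow> (real \<Rightarrow> nat) \<Rightarrow> real \<Rightarrow> 'w \<Rightarrow> ennreal"
where
  "transfer_time \<Delta> r X \<pi> F \<omega> = (\<Sum>n. ennreal (slot_time \<Delta> r X \<pi> F \<omega> n))"

definition expected_time ::
  "'w measure \<Rightarrow> real \<Rightarrow> (nat \<Rightarrow> real) \<Rightarrow> (nat \<Rightarrow> nat \<Rightarrow> 'w \<Rightarrow> bool) \<Rightarrow> (real \<Rightarrow> nat) \<Rightarrow> real \<Rightarrow> ennreal"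
where
  "expected_time M \<Delta> r X \<pi> F = (\<integral>\<^sup>+\<omega>. transfer_time \<Delta> r X \<pi> F \<omega> \<partial>M)"

definition is_optimal_policy ::
  "nat \<Rightarrow> 'w measure \<Rightarrow> real \<Rightarrow> (nat \<Rightarrow> real) \<Rightarrow> (nat \<Rightarrow> nat \<Rightarrow> 'w \<Rightarrow> bool) \<Rightarrow> real \<Rightarrow> (real \<Rightarrow> nat) \<Rightarrow> bool"
where
  "is_optimal_policy N M \<Delta> r X F \<pi> \<longleftrightarrow>
     is_arg_min (\<lambda>\<pi>. expected_time M \<Delta> r X \<pi> F) (\<lambda>\<pi>. \<pi> \<in> policies N) \<pi>"

end

theory Submission imports Defs begin

text \<open>
  A transfer is a Markov chain on the remaining sizes, and everything rests on comparing expected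
  transfer times with explicit value functions. Let \<open>\<B> W s\<close> be the expected duration of a slot
  that starts at size \<open>s\<close> plus the expected value of \<open>W\<close> at the next size. If \<open>\<B> W \<le> W\<close>, then the
  expected time spent during the first \<open>n\<close> slots is at most \<open>W F\<close> minus the expected value of
  \<open>W\<close> after them, hence at most \<open>W F\<close> (\<open>expected_time_le\<close>). If \<open>W \<le> \<B> W\<close>, the same telescoping
  gives \<open>W F\<close> as a lower bound once the expected value of \<open>W\<close> after \<open>n\<close> slots tends to zero; it
  does so as soon as \<open>W\<close> is dominated by a multiple of the slot costs, whose expected sum may be
  assumed finite (\<open>le_expected_time\<close>).

  Three value functions, with \<open>j\<close> the max-throughput channel, give the result.

  \<^item> \<open>s / (r j * p j)\<close> bounds every policy from below, because no channel
    transfers more than \<open>r j * p j\<close> per unit of time on average.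
  \<^item> A static policy on \<open>i\<close> needs \<open>\<lceil>s / (\<Delta> * r i)\<rceil>\<close> successful slots, each preceded by an
    expected waste of \<open>\<Delta> * (1 - p i) / p i\<close>, besides the pure transmission time \<open>s / r i\<close>.
    This is exact. Together with the first bound it gives the left inequality, where
    \<open>k * \<Delta> * r j \<le> F\<close> absorbs the waste of the first \<open>k\<close> successful slots.
  \<^item> The policy that stays on \<open>j\<close> for the \<open>k\<close> full slots and moves to \<open>i\<close> for the
    remainder \<open>F - k * \<Delta> * r j\<close> costs \<open>k * \<Delta> / p j\<close>, plus at most the time of the
    static policy on \<open>i\<close> for the remainder. The optimal policy is no worse, and dividing this cost
    by the waste \<open>(k + 1) * \<Delta> * (1 - p j) / p j\<close>, a lower bound for the static time
    on \<open>j\<close>, gives the right inequality after scaling by \<open>p i / \<Delta>\<close>.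
\<close>

section \<open>Sizes that are functions of finitely many channel states\<close>

lemma remaining_size_bounds:
  assumes "0 \<le> F" "0 \<le> \<Delta>" "\<And>i. i \<in> {1..N} \<Longrightarrow> 0 \<le> r i" "\<pi> \<in> policies N"
  shows "0 \<le> remaining_size \<Delta> r X \<pi> F \<omega> n \<and> remaining_size \<Delta> r X \<pi> F \<omega> n \<le> F"
proof (induction n)
  case (Suc n)
  let ?s = "remaining_size \<Delta> r X \<pi> F \<omega> n"
  have "0 \<le> \<Delta> * r (\<pi> ?s)"
    using Suc assms by (intro mult_nonneg_nonneg assms(3)) (auto simp: policies_def)
  then show ?case using Suc by (auto simp: Let_def)
qed (use assms in auto)

lemma remaining_size_cong:
  assumes "0 \<le> F" "0 \<le> \<Delta>" "\<And>i. i \<in> {1..N} \<Longrightarrow> 0 \<le> r i" "\<pi> \<in> policies N"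
    and "\<And>m i. m < n \<Longrightarrow> i \<in> {1..N} \<Longrightarrow> X m i \<omega> = Y m i \<omega>'"
  shows "remaining_size \<Delta> r X \<pi> F \<omega> n = remaining_size \<Delta> r Y \<pi> F \<omega>' n"
  using assms(5)
proof (induction n)
  case (Suc n)
  let ?s = "remaining_size \<Delta> r X \<pi> F \<omega> n"
  have "remaining_size \<Delta> r Y \<pi> F \<omega>' n = ?s"
    using Suc by simp
  moreover have "\<pi> ?s \<in> {1..N}"
    using assms(4) remaining_size_bounds[OF assms(1-4), where X=X and \<omega>=\<omega> and n=n] by (auto simp: policies_def)
  then have "X n (\<pi> ?s) \<omega> = Y n (\<pi> ?s) \<omega>'"
    by (intro Suc.prems) auto
  ultimately show ?case by (simp add: Let_def)
qed simp

text \<open>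
  The trial \<open>B (S \<omega>)\<close> is selected by the current state, so it need not be independent of \<open>S\<close> as a
  random variable. It suffices that each fixed trial \<open>B v\<close> is independent of the event \<open>S = v\<close>:
  the expectation splits over the finitely many values of \<open>S\<close>. That \<open>S\<close> is simple is what admits
  arbitrary functions \<open>g\<close> and \<open>q\<close> of it, and with them arbitrary policies and value functions.
\<close>

lemma (in prob_space) expectation_independent_trial:
  fixes g :: "'b \<Rightarrow> bool \<Rightarrow> real"
  assumes S: "simple_function M S"
    and B: "\<And>v. v \<in> S ` space M \<Longrightarrow> {\<omega> \<in> space M. B v \<omega>} \<in> events"
    and indep: "\<And>v. v \<in> S ` space M \<Longrightarrow>
      prob {\<omega> \<in> space M. S \<omega> = v \<and> B v \<omega>} = prob {\<omega> \<in> space M. S \<omega> = v} * q v"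
  shows "integrable M (\<lambda>\<omega>. g (S \<omega>) (B (S \<omega>) \<omega>))" (is ?int)
    and "expectation (\<lambda>\<omega>. g (S \<omega>) (B (S \<omega>) \<omega>)) =
      expectation (\<lambda>\<omega>. q (S \<omega>) * g (S \<omega>) True + (1 - q (S \<omega>)) * g (S \<omega>) False)" (is ?eq)
proof -
  define V where "V = S ` space M"
  define A where "A v = {\<omega> \<in> space M. S \<omega> = v}" for v
  define C where "C v = {\<omega> \<in> space M. S \<omega> = v \<and> B v \<omega>}" for v
  have fin: "finite V"
    using S by (auto simp: V_def simple_function_def)
  have A: "A v \<in> events" if "v \<in> V" for v
  proof -
    have "A v = S -` {v} \<inter> space M" by (auto simp: A_def)
    then show ?thesis using S that by (auto simp: V_def simple_function_def)
  qed
  have C: "C v \<in> events" if "v \<in> V" for v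
  proof -
    have "C v = A v \<inter> {\<omega> \<in> space M. B v \<omega>}" by (auto simp: A_def C_def)
    then show ?thesis using A[OF that] B[of v] that by (auto simp: V_def)
  qed
  let ?L = "\<lambda>\<omega>. \<Sum>v\<in>V. indicator (C v) \<omega> * (g v True - g v False) + indicator (A v) \<omega> * g v False"
  let ?R = "\<lambda>\<omega>. \<Sum>v\<in>V. indicator (A v) \<omega> * (q v * g v True + (1 - q v) * g v False)"
  have L: "g (S \<omega>) (B (S \<omega>) \<omega>) = ?L \<omega>" if "\<omega> \<in> space M" for \<omega>
  proof -
    have "?L \<omega> = (\<Sum>v\<in>V. if v = S \<omega> then g (S \<omega>) (B (S \<omega>) \<omega>) else 0)"
      using that by (intro sum.cong) (auto simp: A_def C_def indicator_def)
    then show ?thesis using fin that by (simp add: V_def)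
  qed
  have R: "q (S \<omega>) * g (S \<omega>) True + (1 - q (S \<omega>)) * g (S \<omega>) False = ?R \<omega>"
    if "\<omega> \<in> space M" for \<omega>
  proof -
    have "?R \<omega> = (\<Sum>v\<in>V. if v = S \<omega> then q (S \<omega>) * g (S \<omega>) True + (1 - q (S \<omega>)) * g (S \<omega>) False else 0)"
      using that by (intro sum.cong) (auto simp: A_def indicator_def)
    then show ?thesis using fin that by (simp add: V_def)
  qed
  have int: "integrable M (\<lambda>\<omega>. indicator (A v) \<omega> * c :: real)"
      "integrable M (\<lambda>\<omega>. indicator (C v) \<omega> * c :: real)" if "v \<in> V" for v c
    using A[OF that] C[OF that] by (auto intro!: integrable_mult_left integrable_real_indicator
        simp: emeasure_eq_measure)
  have mean: "expectation (\<lambda>\<omega>. indicator (C v) \<omega> * c + indicator (A v) \<omega> * d) =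
      prob (C v) * c + prob (A v) * d" if "v \<in> V" for v c d
    using A[OF that] C[OF that]
    by (subst Bochner_Integration.integral_add[OF int(2)[OF that] int(1)[OF that]]) auto
  have "integrable M ?L"
    by (intro Bochner_Integration.integrable_sum Bochner_Integration.integrable_add int)
  then show ?int
    by (subst Bochner_Integration.integrable_cong[OF refl L])
  have "expectation (\<lambda>\<omega>. g (S \<omega>) (B (S \<omega>) \<omega>)) = expectation ?L"
    by (intro Bochner_Integration.integral_cong refl L)
  also have "\<dots> = (\<Sum>v\<in>V. prob (C v) * (g v True - g v False) + prob (A v) * g v False)"
    by (subst Bochner_Integration.integral_sum) (auto intro!: sum.cong
        Bochner_Integration.integrable_add int simp: mean)
  also have "\<dots> = (\<Sum>v\<in>V. prob (A v) * (q v * g v True + (1 - q v) * g v False))"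
    using indep by (intro sum.cong) (auto simp: A_def C_def V_def algebra_simps)
  also have "\<dots> = expectation ?R"
    by (subst Bochner_Integration.integral_sum, erule int(1)) (auto intro!: sum.cong simp: Int_absorb2 sets.sets_into_space[OF A])
  also have "\<dots> = expectation (\<lambda>\<omega>. q (S \<omega>) * g (S \<omega>) True + (1 - q (S \<omega>)) * g (S \<omega>) False)"
    by (intro Bochner_Integration.integral_cong refl R[symmetric])
  finally show ?eq .
qed

section \<open>The transfer as a controlled Markov chain\<close>

locale slotted_channels = prob_space M
  for M :: "'w measure" +
  fixes N :: nat and \<Delta> :: real and r p :: "nat \<Rightarrow> real" and X :: "nat \<Rightarrow> nat \<Rightarrow> 'w \<Rightarrow> bool"
  assumes slot_pos: "0 < \<Delta>"
    and rate_pos: "i \<in> {1..N} \<Longrightarrow> 0 < r i"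
    and avail_pos: "i \<in> {1..N} \<Longrightarrow> 0 < p i"
    and avail_le_1: "i \<in> {1..N} \<Longrightarrow> p i \<le> 1"
    and indep_avail: "indep_vars (\<lambda>_. count_space UNIV) (\<lambda>(n, i). X n i) (UNIV \<times> {1..N})"
    and prob_avail: "i \<in> {1..N} \<Longrightarrow> prob {\<omega> \<in> space M. X n i \<omega>} = p i"
begin

definition slot_cost :: "(real \<Rightarrow> nat) \<Rightarrow> real \<Rightarrow> real" where
  "slot_cost \<pi> s = (let i = \<pi> s in
     if 0 < s then p i * min \<Delta> (s / r i) + (1 - p i) * \<Delta> else 0)"

text \<open>
  Size \<open>0\<close> is absorbing, which makes the balance equation \<open>expectation_next_size\<close> hold in all
  slots, including those after the transfer has ended.
\<close>

definition bellman :: "(real \<Rightarrow> nat) \<Rightarrow> (real \<Rightarrow> real) \<Rightarrow> real \<Rightarrow> real" where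
  "bellman \<pi> W s = slot_cost \<pi> s + (let i = \<pi> s in
     if 0 < s then p i * W (max 0 (s - \<Delta> * r i)) + (1 - p i) * W s else W s)"

lemma bellman_pos:
  "0 < s \<Longrightarrow> \<pi> s = i \<Longrightarrow> bellman \<pi> W s =
    p i * (min \<Delta> (s / r i) + W (max 0 (s - \<Delta> * r i))) + (1 - p i) * (\<Delta> + W s)"
  by (simp add: bellman_def slot_cost_def Let_def algebra_simps)

lemma bellman_last_slot:
  assumes "0 < s" "\<pi> s = i" "i \<in> {1..N}" "s \<le> \<Delta> * r i"
  shows "bellman \<pi> W s = p i * (s / r i + W 0) + (1 - p i) * (\<Delta> + W s)"
proof -
  have "min \<Delta> (s / r i) = s / r i" "max 0 (s - \<Delta> * r i) = 0"
    using assms rate_pos[of i] by (auto simp: min_def max_def field_simps)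
  then show ?thesis by (simp only: bellman_pos[of s \<pi> i, OF assms(1,2)])
qed

lemma bellman_full_slot:
  assumes "0 < s" "\<pi> s = i" "i \<in> {1..N}" "\<Delta> * r i \<le> s"
  shows "bellman \<pi> W s = p i * (\<Delta> + W (s - \<Delta> * r i)) + (1 - p i) * (\<Delta> + W s)"
proof -
  have "min \<Delta> (s / r i) = \<Delta>" "max 0 (s - \<Delta> * r i) = s - \<Delta> * r i"
    using assms rate_pos[of i] by (auto simp: min_def max_def field_simps)
  then show ?thesis by (simp only: bellman_pos[of s \<pi> i, OF assms(1,2)])
qed

lemma bellman_0: "bellman \<pi> W 0 = W 0"
  by (simp add: bellman_def slot_cost_def Let_def)

lemma avail_event:
  assumes "i \<in> {1..N}"
  shows "{\<omega> \<in> space M. X n i \<omega>} \<in> events"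
proof -
  have "X n i \<in> measurable M (count_space UNIV)"
    using indep_avail assms unfolding indep_vars_def by force
  then show ?thesis by measurable
qed

end

locale file_transfer = slotted_channels +
  fixes \<pi> :: "real \<Rightarrow> nat" and F :: real
  assumes policy: "\<pi> \<in> policies N" and size_nonneg: "0 \<le> F"
begin

abbreviation size_at :: "nat \<Rightarrow> 'a \<Rightarrow> real" where
  "size_at n \<omega> \<equiv> remaining_size \<Delta> r X \<pi> F \<omega> n"

lemma size_at_bounds: "0 \<le> size_at n \<omega>" "size_at n \<omega> \<le> F"
  using remaining_size_bounds[of F \<Delta> N r \<pi>, where X=X and \<omega>=\<omega> and n=n] policy size_nonneg slot_pos rate_pos
  by (auto intro: less_imp_le)

lemma policy_size_at: "\<pi> (size_at n \<omega>) \<in> {1..N}"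
  using policy size_at_bounds[of \<omega> n] by (auto simp: policies_def)

text \<open>
  The size at the start of slot \<open>n\<close> is a function \<open>h\<close> of the finitely many availabilities in earlier
  slots. These take finitely many joint values, on which every set is measurable, and they are
  independent of the availabilities in slot \<open>n\<close>.
\<close>

lemma size_at_independent_of_slot:
  shows simple_size_at: "simple_function M (size_at n)"
    and "i \<in> {1..N} \<Longrightarrow> prob {\<omega> \<in> space M. size_at n \<omega> = v \<and> X n i \<omega>} =
      prob {\<omega> \<in> space M. size_at n \<omega> = v} * p i"
proof -
  define past where "past = {..<n} \<times> {1..N}"
  define R where "R \<omega> = restrict (\<lambda>x. (case x of (m, j) \<Rightarrow> X m j) \<omega>) past" for \<omega>
  \<comment> \<open>The recursion for the sizes, run on recorded availabilities instead of outcomes.\<close>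
  define h where "h f = remaining_size \<Delta> r (\<lambda>m j f. f (m, j)) \<pi> F f n" for f :: "nat \<times> nat \<Rightarrow> bool"
  let ?P = "past \<rightarrow>\<^sub>E (UNIV :: bool set)"
  have fin: "finite past" by (simp add: past_def)
  have h: "size_at n \<omega> = h (R \<omega>)" for \<omega>
    unfolding h_def using policy size_nonneg slot_pos rate_pos
    by (intro remaining_size_cong[of F \<Delta> N]) (auto simp: R_def past_def less_imp_le)
  have PiM: "PiM K (\<lambda>_. count_space (UNIV :: bool set)) = count_space (K \<rightarrow>\<^sub>E UNIV)"
    if "finite K" for K :: "(nat \<times> nat) set"
    using that by (intro count_space_PiM_finite) auto
  have ind: "indep_var (count_space ?P) R (count_space ({(n, i)} \<rightarrow>\<^sub>E UNIV))
      (\<lambda>\<omega>. restrict (\<lambda>x. (case x of (m, j) \<Rightarrow> X m j) \<omega>) {(n, i)})" if "i \<in> {1..N}" for i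
    using indep_var_restrict[OF indep_avail, of past "{(n, i)}"] that fin
    by (auto simp: past_def R_def[abs_def] PiM)
  have R: "R \<in> measurable M (count_space ?P)"
  proof -
    have "R \<in> measurable M (PiM past (\<lambda>_. count_space UNIV))"
      unfolding R_def using indep_avail
      by (intro measurable_restrict) (auto simp: indep_vars_def past_def)
    then show ?thesis using fin by (simp add: PiM)
  qed
  show "simple_function M (size_at n)"
    unfolding simple_function_def
  proof (intro conjI ballI)
    have "size_at n ` space M \<subseteq> h ` ?P"
      using h by (auto simp: R_def)
    then show "finite (size_at n ` space M)"
      by (rule finite_subset) (auto intro!: finite_imageI finite_PiE fin)
    fix v
    have "size_at n -` {v} \<inter> space M = R -` {f \<in> ?P. h f = v} \<inter> space M"
      using h by (auto simp: R_def)
    then show "size_at n -` {v} \<inter> space M \<in> events"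
      using measurable_sets[OF R, of "{f \<in> ?P. h f = v}"] by simp
  qed
  assume i: "i \<in> {1..N}"
  let ?Q = "\<lambda>\<omega>. restrict (\<lambda>x. (case x of (m, j) \<Rightarrow> X m j) \<omega>) {(n, i)}"
  let ?VR = "{f \<in> ?P. h f = v}" and ?VQ = "{f \<in> {(n, i)} \<rightarrow>\<^sub>E UNIV. f (n, i)}"
  have "prob ((\<lambda>\<omega>. (R \<omega>, ?Q \<omega>)) -` (?VR \<times> ?VQ) \<inter> space M) =
      prob (R -` ?VR \<inter> space M) * prob (?Q -` ?VQ \<inter> space M)"
    by (rule indep_varD[OF ind[OF i]]) auto
  moreover have "(\<lambda>\<omega>. (R \<omega>, ?Q \<omega>)) -` (?VR \<times> ?VQ) \<inter> space M =
      {\<omega> \<in> space M. size_at n \<omega> = v \<and> X n i \<omega>}"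
    using h by (auto simp: R_def)
  moreover have "R -` ?VR \<inter> space M = {\<omega> \<in> space M. size_at n \<omega> = v}"
    using h by (auto simp: R_def)
  moreover have "?Q -` ?VQ \<inter> space M = {\<omega> \<in> space M. X n i \<omega>}"
    by auto
  ultimately show "prob {\<omega> \<in> space M. size_at n \<omega> = v \<and> X n i \<omega>} =
      prob {\<omega> \<in> space M. size_at n \<omega> = v} * p i"
    using prob_avail[OF i] by simp
qed

lemma expectation_slot:
  fixes g :: "real \<Rightarrow> bool \<Rightarrow> real"
  defines "G \<equiv> \<lambda>s. p (\<pi> s) * g s True + (1 - p (\<pi> s)) * g s False"
  shows "integrable M (\<lambda>\<omega>. g (size_at n \<omega>) (X n (\<pi> (size_at n \<omega>)) \<omega>))"
    and "expectation (\<lambda>\<omega>. g (size_at n \<omega>) (X n (\<pi> (size_at n \<omega>)) \<omega>)) =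
      expectation (\<lambda>\<omega>. G (size_at n \<omega>))"
proof -
  let ?B = "\<lambda>v \<omega>. X n (\<pi> v) \<omega>"
  have ev: "{\<omega> \<in> space M. ?B v \<omega>} \<in> events" if "v \<in> size_at n ` space M" for v
    using that policy_size_at avail_event by blast
  have ind: "prob {\<omega> \<in> space M. size_at n \<omega> = v \<and> ?B v \<omega>} =
      prob {\<omega> \<in> space M. size_at n \<omega> = v} * p (\<pi> v)" if "v \<in> size_at n ` space M" for v
    using that policy_size_at size_at_independent_of_slot(2) by blast
  note trial = expectation_independent_trial[OF simple_size_at, where B = ?B and q = "\<lambda>v. p (\<pi> v)",
      OF ev ind, where g = g]
  show "integrable M (\<lambda>\<omega>. g (size_at n \<omega>) (X n (\<pi> (size_at n \<omega>)) \<omega>))"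
    by (rule trial(1))
  show "expectation (\<lambda>\<omega>. g (size_at n \<omega>) (X n (\<pi> (size_at n \<omega>)) \<omega>)) =
      expectation (\<lambda>\<omega>. G (size_at n \<omega>))"
    unfolding G_def by (rule trial(2))
qed

lemma integrable_size_at: "integrable M (\<lambda>\<omega>. f (size_at n \<omega>) :: real)"
  using expectation_slot(1)[of "\<lambda>s _. f s"] by simp

definition duration :: "real \<Rightarrow> bool \<Rightarrow> real" where
  "duration s available = (if 0 < s then if available then min \<Delta> (s / r (\<pi> s)) else \<Delta> else 0)"

lemma slot_time_eq:
  "slot_time \<Delta> r X \<pi> F \<omega> n = duration (size_at n \<omega>) (X n (\<pi> (size_at n \<omega>)) \<omega>)"
  by (simp add: slot_time_def duration_def Let_def)

lemma integrable_slot_time: "integrable M (\<lambda>\<omega>. slot_time \<Delta> r X \<pi> F \<omega> n)"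
  unfolding slot_time_eq by (rule expectation_slot)

lemma expectation_slot_time:
  "expectation (\<lambda>\<omega>. slot_time \<Delta> r X \<pi> F \<omega> n) = expectation (\<lambda>\<omega>. slot_cost \<pi> (size_at n \<omega>))"
  unfolding slot_time_eq expectation_slot(2)[where g = duration]
  by (intro Bochner_Integration.integral_cong) (auto simp: duration_def slot_cost_def Let_def)

lemma expectation_next_size:
  "expectation (\<lambda>\<omega>. slot_time \<Delta> r X \<pi> F \<omega> n) + expectation (\<lambda>\<omega>. W (size_at (Suc n) \<omega>)) =
    expectation (\<lambda>\<omega>. bellman \<pi> W (size_at n \<omega>))"
proof -
  let ?g = "\<lambda>s b. W (if 0 < s \<and> b then max 0 (s - \<Delta> * r (\<pi> s)) else s)"
  have "expectation (\<lambda>\<omega>. W (size_at (Suc n) \<omega>)) =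
      expectation (\<lambda>\<omega>. ?g (size_at n \<omega>) (X n (\<pi> (size_at n \<omega>)) \<omega>))"
    by (simp add: Let_def)
  also have "\<dots> = expectation (\<lambda>\<omega>. bellman \<pi> W (size_at n \<omega>) - slot_cost \<pi> (size_at n \<omega>))"
    unfolding expectation_slot(2)[where g = ?g]
    by (intro Bochner_Integration.integral_cong) (auto simp: bellman_def Let_def algebra_simps)
  also have "\<dots> = expectation (\<lambda>\<omega>. bellman \<pi> W (size_at n \<omega>)) -
      expectation (\<lambda>\<omega>. slot_time \<Delta> r X \<pi> F \<omega> n)"
    unfolding expectation_slot_time
    by (intro Bochner_Integration.integral_diff integrable_size_at)
  finally show ?thesis by simp
qed

lemma slot_time_nonneg: "0 \<le> slot_time \<Delta> r X \<pi> F \<omega> n"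
  using slot_pos rate_pos[OF policy_size_at[of \<omega> n]] by (auto simp: slot_time_def Let_def)

lemma expected_time_eq_suminf:
  "expected_time M \<Delta> r X \<pi> F = (\<Sum>n. ennreal (expectation (\<lambda>\<omega>. slot_time \<Delta> r X \<pi> F \<omega> n)))"
proof -
  have "expected_time M \<Delta> r X \<pi> F = (\<Sum>n. \<integral>\<^sup>+\<omega>. ennreal (slot_time \<Delta> r X \<pi> F \<omega> n) \<partial>M)"
    unfolding expected_time_def transfer_time_def
    using integrable_slot_time by (intro nn_integral_suminf) auto
  then show ?thesis
    by (simp add: nn_integral_eq_integral integrable_slot_time slot_time_nonneg)
qed

text \<open>
  Summing the balance equation over the first \<open>m\<close> slots bounds the time spent in them by \<open>W F\<close>
  minus the expected final value, which is nonnegative.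
\<close>

lemma expected_time_le:
  assumes W: "\<And>s. 0 \<le> s \<Longrightarrow> 0 \<le> W s"
    and super: "\<And>s. 0 < s \<Longrightarrow> bellman \<pi> W s \<le> W s"
  shows "expected_time M \<Delta> r X \<pi> F \<le> ennreal (W F)"
proof -
  let ?t = "\<lambda>n. expectation (\<lambda>\<omega>. slot_time \<Delta> r X \<pi> F \<omega> n)"
  let ?a = "\<lambda>n. expectation (\<lambda>\<omega>. W (size_at n \<omega>))"
  have bell: "bellman \<pi> W (size_at n \<omega>) \<le> W (size_at n \<omega>)" for n \<omega>
    using super[of "size_at n \<omega>"] size_at_bounds(1)[of \<omega> n] bellman_0[of \<pi> W]
    by (cases "size_at n \<omega> = 0") auto
  have step: "?t n + ?a (Suc n) \<le> ?a n" for n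
    unfolding expectation_next_size by (intro integral_mono integrable_size_at bell)
  have "(\<Sum>n<m. ?t n) + ?a m \<le> W F" for m
  proof (induction m)
    case (Suc m)
    then show ?case using step[of m] by simp
  qed (simp add: prob_space)
  moreover have "0 \<le> ?a m" for m
    using W size_at_bounds(1) by (intro integral_nonneg_AE) auto
  ultimately have "(\<Sum>n<m. ?t n) \<le> W F" for m
    by (meson le_add_same_cancel1 order_trans)
  moreover have "0 \<le> ?t n" for n
    by (intro integral_nonneg_AE) (auto simp: slot_time_nonneg)
  ultimately show ?thesis
    unfolding expected_time_eq_suminf suminf_eq_SUP
    by (intro SUP_least) (simp add: sum_ennreal ennreal_leI)
qed

text \<open>
  In the telescoped sum the expected value left after \<open>m\<close> slots has to vanish in the limit. If the
  expected transfer time is finite, the expected slot times are summable and tend to zero, and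
  the comparison with \<open>slot_cost\<close> carries this over to \<open>W\<close>.
\<close>

lemma le_expected_time:
  assumes W: "\<And>s. 0 \<le> s \<Longrightarrow> s \<le> F \<Longrightarrow> 0 \<le> W s"
    and sub: "\<And>s. 0 < s \<Longrightarrow> W s \<le> bellman \<pi> W s"
    and c: "0 < c" "\<And>s. 0 \<le> s \<Longrightarrow> s \<le> F \<Longrightarrow> c * W s \<le> slot_cost \<pi> s"
  shows "ennreal (W F) \<le> expected_time M \<Delta> r X \<pi> F"
proof (cases "expected_time M \<Delta> r X \<pi> F = top")
  case False
  let ?t = "\<lambda>n. expectation (\<lambda>\<omega>. slot_time \<Delta> r X \<pi> F \<omega> n)"
  let ?a = "\<lambda>n. expectation (\<lambda>\<omega>. W (size_at n \<omega>))"
  have t: "0 \<le> ?t n" for n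
    by (intro integral_nonneg_AE) (auto simp: slot_time_nonneg)
  have a: "0 \<le> ?a n" for n
    using W size_at_bounds by (intro integral_nonneg_AE) auto
  have summable: "summable ?t"
    using False t by (intro summable_suminf_not_top) (auto simp: expected_time_eq_suminf)
  have bell: "W (size_at n \<omega>) \<le> bellman \<pi> W (size_at n \<omega>)" for n \<omega>
    using sub[of "size_at n \<omega>"] size_at_bounds(1)[of \<omega> n] bellman_0[of \<pi> W]
    by (cases "size_at n \<omega> = 0") auto
  have step: "?a n \<le> ?t n + ?a (Suc n)" for n
    unfolding expectation_next_size by (intro integral_mono integrable_size_at bell)
  have partial: "W F \<le> (\<Sum>n<m. ?t n) + ?a m" for m
  proof (induction m)
    case (Suc m)
    then show ?case using step[of m] by simp
  qed (simp add: prob_space)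
  have "c * ?a n \<le> ?t n" for n
  proof -
    have "c * ?a n = expectation (\<lambda>\<omega>. c * W (size_at n \<omega>))" by simp
    also have "\<dots> \<le> ?t n"
      unfolding expectation_slot_time
      by (intro integral_mono integrable_mult_right integrable_size_at c size_at_bounds)
    finally show ?thesis .
  qed
  then have a_le: "?a n \<le> ?t n / c" for n
    using c(1) by (simp add: pos_le_divide_eq mult.commute)
  have lim: "(\<lambda>n. ?t n / c) \<longlonglongrightarrow> 0"
    using tendsto_divide[OF summable_LIMSEQ_zero[OF summable] tendsto_const[of c]] c(1) by simp
  have "?a \<longlonglongrightarrow> 0"
    by (rule tendsto_sandwich[OF always_eventually always_eventually tendsto_const lim])
      (use a a_le in auto)
  then have "(\<lambda>m. (\<Sum>n<m. ?t n) + ?a m) \<longlonglongrightarrow> suminf ?t + 0"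
    by (intro tendsto_add summable_LIMSEQ summable)
  then have "W F \<le> suminf ?t"
    using partial by (intro LIMSEQ_le_const) auto
  then show ?thesis
    using summable t by (simp add: expected_time_eq_suminf suminf_ennreal2 ennreal_leI)
qed simp

end

section \<open>Value functions\<close>

context slotted_channels
begin

lemma file_transferI: "\<pi> \<in> policies N \<Longrightarrow> 0 \<le> F \<Longrightarrow> file_transfer M N \<Delta> r p X \<pi> F"
  by (simp add: file_transfer_def file_transfer_axioms_def slotted_channels_axioms)

text \<open>
  A slot of expected duration \<open>p * \<tau> + (1 - p) * \<Delta> \<ge> \<tau>\<close> removes \<open>p * r * \<tau>\<close> on average, where \<open>\<tau>\<close> is
  the time that an available channel would need.
\<close>

lemma throughput_bound_le_expected_time:
  assumes j: "j \<in> {1..N}" and max: "\<And>i. i \<in> {1..N} \<Longrightarrow> r i * p i \<le> r j * p j"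
    and \<pi>: "\<pi> \<in> policies N" and F: "0 \<le> F"
  shows "ennreal (F / (r j * p j)) \<le> expected_time M \<Delta> r X \<pi> F"
proof -
  interpret file_transfer M N \<Delta> r p X \<pi> F
    using \<pi> F by (rule file_transferI)
  define \<theta> where "\<theta> = r j * p j"
  define R where "R = Max (r ` {1..N})"
  \<comment> \<open>An available slot lasts \<open>\<Delta> \<ge> \<Delta> * s / (F + 1)\<close> or \<open>s / r i \<ge> s / R\<close>, thus at least \<open>c * s\<close>;
    the summand 1 keeps the constant positive for \<open>F = 0\<close>.\<close>
  define c where "c = min (\<Delta> / (F + 1)) (1 / R)"
  have \<theta>: "0 < \<theta>" using rate_pos avail_pos j by (simp add: \<theta>_def)
  have R: "r i \<le> R" if "i \<in> {1..N}" for i using that by (simp add: R_def)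
  have R_pos: "0 < R" using R[OF j] rate_pos[OF j] by simp
  have c_pos: "0 < c" using R_pos F slot_pos by (simp add: c_def)
  show ?thesis unfolding \<theta>_def[symmetric]
  proof (rule le_expected_time)
    show "0 \<le> s / \<theta>" if "0 \<le> s" for s using that \<theta> by simp
    show "0 < c * \<theta>" using c_pos \<theta> by simp
  next
    fix s :: real assume s: "0 < s"
    define i where "i = \<pi> s"
    define \<tau> where "\<tau> = min \<Delta> (s / r i)"
    have i: "i \<in> {1..N}" using policy s by (auto simp: i_def policies_def)
    have \<tau>: "0 \<le> \<tau>" "\<tau> \<le> \<Delta>"
      using s slot_pos rate_pos[OF i] by (auto simp: \<tau>_def)
    have next_size: "max 0 (s - \<Delta> * r i) = s - r i * \<tau>"
      using rate_pos[OF i] by (auto simp: \<tau>_def min_def max_def field_simps)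
    have "r i * p i / \<theta> * \<tau> \<le> 1 * \<tau>"
      using max[OF i] \<theta> \<tau> by (intro mult_right_mono) (auto simp: \<theta>_def)
    also have "\<dots> \<le> p i * \<tau> + (1 - p i) * \<Delta>"
      using mult_left_mono[OF \<tau>(2), of "1 - p i"] avail_le_1[OF i] by (simp add: algebra_simps)
    finally show "s / \<theta> \<le> bellman \<pi> (\<lambda>s. s / \<theta>) s"
      unfolding bellman_pos[of s \<pi> i, OF s i_def[symmetric]] next_size \<tau>_def[symmetric]
      by (simp add: algebra_simps diff_divide_distrib add_divide_distrib)
  next
    fix s assume s: "0 \<le> s" "s \<le> F"
    define i where "i = \<pi> s"
    have i: "i \<in> {1..N}" using policy s by (auto simp: i_def policies_def)
    show "c * \<theta> * (s / \<theta>) \<le> slot_cost \<pi> s"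
    proof (cases "s = 0")
      case False
      define \<tau> where "\<tau> = min \<Delta> (s / r i)"
      have "c * s \<le> \<Delta> / (F + 1) * (F + 1)"
        using s F slot_pos by (intro mult_mono) (auto simp: c_def)
      moreover have "c * s \<le> 1 / r i * s"
        using s R[OF i] rate_pos[OF i] R_pos
        by (intro mult_right_mono) (auto simp: c_def intro!: min.coboundedI2 divide_left_mono)
      ultimately have "c * s \<le> \<tau>" using F by (simp add: \<tau>_def)
      also have "\<tau> \<le> p i * \<tau> + (1 - p i) * \<Delta>"
        using mult_left_mono[of \<tau> \<Delta> "1 - p i"] avail_le_1[OF i] by (simp add: algebra_simps \<tau>_def)
      finally show ?thesis
        using \<theta> s False by (simp add: slot_cost_def Let_def i_def[symmetric] \<tau>_def)
    qed (simp add: slot_cost_def Let_def)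
  qed
qed

definition static_time :: "nat \<Rightarrow> real \<Rightarrow> real" where
  "static_time i s = s / r i + of_int \<lceil>s / (\<Delta> * r i)\<rceil> * (\<Delta> * (1 - p i) / p i)"

lemma static_time_nonneg:
  assumes "i \<in> {1..N}" "0 \<le> s" shows "0 \<le> static_time i s"
proof -
  have "0 \<le> s / (\<Delta> * r i)" using assms slot_pos rate_pos[of i] by simp
  then have "0 \<le> \<lceil>s / (\<Delta> * r i)\<rceil>" by linarith
  then show ?thesis
    using assms slot_pos rate_pos[of i] avail_pos[of i] avail_le_1[of i] by (simp add: static_time_def)
qed

lemma bellman_static_time:
  assumes i: "i \<in> {1..N}" and s: "0 < s"
  shows "bellman (\<lambda>_. i) (static_time i) s = static_time i s"
proof (cases "s \<le> \<Delta> * r i")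
  case True
  have "0 < s / (\<Delta> * r i)" "s / (\<Delta> * r i) \<le> 1"
    using True s slot_pos rate_pos[OF i] by simp_all
  then have "\<lceil>s / (\<Delta> * r i)\<rceil> = 1" by linarith
  then show ?thesis
    using True s slot_pos rate_pos[OF i] avail_pos[OF i]
    by (simp add: bellman_last_slot[OF s _ i] static_time_def field_simps)
next
  case False
  have quot: "(s - \<Delta> * r i) / (\<Delta> * r i) = s / (\<Delta> * r i) - 1"
    using slot_pos rate_pos[OF i] by (simp add: field_simps)
  have ceil: "of_int \<lceil>s / (\<Delta> * r i) - 1\<rceil> = (of_int \<lceil>s / (\<Delta> * r i)\<rceil> - 1 :: real)"
    by simp
  have "static_time i (s - \<Delta> * r i) = static_time i s - (\<Delta> + \<Delta> * (1 - p i) / p i)"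
    using rate_pos[OF i] unfolding static_time_def quot ceil
    by (simp add: left_diff_distrib diff_divide_distrib)
  also have "\<Delta> + \<Delta> * (1 - p i) / p i = \<Delta> / p i"
    using avail_pos[OF i] by (simp add: field_simps)
  finally have "static_time i (s - \<Delta> * r i) = static_time i s - \<Delta> / p i" .
  then show ?thesis
    using False avail_pos[OF i] by (simp add: bellman_full_slot[OF s _ i] field_simps)
qed

text \<open>
  As \<open>static_time\<close> solves the Bellman equation, it is both an upper and a lower bound. It does not
  vanish as \<open>s\<close> tends to zero from above; \<open>p i < 1\<close> makes every slot before completion cost at
  least \<open>(1 - p i) * \<Delta>\<close>, which dominates a multiple of it all the same.
\<close>

lemma expected_time_static:
  assumes i: "i \<in> {1..N}" and p: "p i < 1" and F: "0 \<le> F"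
  shows "expected_time M \<Delta> r X (\<lambda>_. i) F = ennreal (static_time i F)"
proof (rule antisym)
  interpret file_transfer M N \<Delta> r p X "\<lambda>_. i" F
    using i F by (intro file_transferI) (auto simp: policies_def)
  show "expected_time M \<Delta> r X (\<lambda>_. i) F \<le> ennreal (static_time i F)"
    by (intro expected_time_le static_time_nonneg i) (simp_all add: bellman_static_time[OF i])
  define c where "c = (1 - p i) * \<Delta> / (static_time i F + 1)"
  have F1: "0 < static_time i F + 1" using static_time_nonneg[OF i F] by simp
  show "ennreal (static_time i F) \<le> expected_time M \<Delta> r X (\<lambda>_. i) F"
  proof (rule le_expected_time)
    show "0 < c" using F1 p slot_pos by (simp add: c_def)
    fix s assume s: "0 \<le> s" "s \<le> F"
    show "c * static_time i s \<le> slot_cost (\<lambda>_. i) s"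
    proof (cases "s = 0")
      case False
      have "static_time i s \<le> static_time i F"
        unfolding static_time_def using s rate_pos[OF i] avail_pos[OF i] p slot_pos
        by (intro add_mono mult_right_mono divide_right_mono of_int_le_iff[THEN iffD2] ceiling_mono) auto
      then have "c * static_time i s \<le> c * (static_time i F + 1)"
        using \<open>0 < c\<close> by (intro mult_left_mono) auto
      also have "\<dots> = (1 - p i) * \<Delta>" using F1 by (simp add: c_def)
      also have "\<dots> \<le> slot_cost (\<lambda>_. i) s"
        using False s slot_pos rate_pos[OF i] avail_pos[OF i] by (simp add: slot_cost_def)
      finally show ?thesis .
    qed (simp add: slot_cost_def static_time_def)
  qed (simp_all add: static_time_nonneg[OF i] bellman_static_time[OF i])
qed

text \<open>
  This is \<open>static_time\<close> with the ceiling replaced by its upper bound \<open>s / (\<Delta> * r i) + 1\<close>.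
\<close>

definition static_time_bound :: "nat \<Rightarrow> real \<Rightarrow> real" where
  "static_time_bound i s = (if 0 < s then s / (r i * p i) + \<Delta> * (1 - p i) / p i else 0)"

lemma bellman_static_time_bound:
  assumes i: "i \<in> {1..N}" and s: "0 < s" and \<pi>: "\<pi> s = i"
  shows "bellman \<pi> (static_time_bound i) s \<le> static_time_bound i s"
proof (cases "s \<le> \<Delta> * r i")
  case True
  have "p i * s \<le> 1 * s"
    using avail_le_1[OF i] s by (intro mult_right_mono) auto
  then show ?thesis
    using True s slot_pos rate_pos[OF i] avail_pos[OF i]
    by (simp add: bellman_last_slot[where \<pi> = \<pi>, OF s \<pi> i] static_time_bound_def field_simps)
next
  case False
  then show ?thesis
    using s slot_pos rate_pos[OF i] avail_pos[OF i]
    by (simp add: bellman_full_slot[where \<pi> = \<pi>, OF s \<pi> i] static_time_bound_def field_simps)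
qed

text \<open>
  With threshold \<open>\<Delta> * r j\<close> an available slot on \<open>j\<close> transfers its full amount, so the fractional part
  of \<open>s / (\<Delta> * r j)\<close> is preserved until the switch and the switching size is known in advance.
\<close>

definition switching_policy :: "nat \<Rightarrow> nat \<Rightarrow> real \<Rightarrow> nat" where
  "switching_policy j i s = (if \<Delta> * r j \<le> s then j else i)"

lemma expected_time_switching_le:
  assumes j: "j \<in> {1..N}" and i: "i \<in> {1..N}" and F: "0 \<le> F"
  shows "expected_time M \<Delta> r X (switching_policy j i) F \<le>
    ennreal (of_int \<lfloor>F / (\<Delta> * r j)\<rfloor> * (\<Delta> / p j) +
      static_time_bound i (\<Delta> * r j * frac (F / (\<Delta> * r j))))"
proof -
  let ?\<pi> = "switching_policy j i"
  interpret file_transfer M N \<Delta> r p X ?\<pi> F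
    using i j F by (intro file_transferI) (auto simp: policies_def switching_policy_def)
  define d where "d = \<Delta> * r j"
  have d: "0 < d" using slot_pos rate_pos[OF j] by (simp add: d_def)
  define W where "W s = of_int \<lfloor>s / d\<rfloor> * (\<Delta> / p j) + static_time_bound i (d * frac (s / d))" for s
  have small: "W s = static_time_bound i s" if "0 \<le> s" "s < d" for s
  proof -
    have "\<lfloor>s / d\<rfloor> = 0" using that by (simp add: floor_eq_iff)
    then show ?thesis using d by (simp add: W_def frac_def)
  qed
  show ?thesis
    unfolding d_def[symmetric] W_def[symmetric]
  proof (rule expected_time_le)
    fix s :: real
    show "0 \<le> W s" if "0 \<le> s"
      using that d slot_pos rate_pos[OF i] avail_pos[OF j] avail_pos[OF i] avail_le_1[OF i]
      by (auto simp: W_def static_time_bound_def intro!: add_nonneg_nonneg)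
    assume s: "0 < s"
    show "bellman ?\<pi> W s \<le> W s"
    proof (cases "d \<le> s")
      case True
      have quot: "(s - d) / d = s / d - 1"
        using d by (simp add: diff_divide_distrib)
      have "W (s - d) = W s - \<Delta> / p j"
        unfolding W_def quot by (simp add: frac_def left_diff_distrib diff_divide_distrib)
      moreover have "?\<pi> s = j"
        using True by (simp add: switching_policy_def d_def)
      ultimately show ?thesis
        using True avail_pos[OF j] bellman_full_slot[where \<pi> = ?\<pi> and W = W, OF s _ j]
        by (simp add: d_def[symmetric] right_diff_distrib left_diff_distrib distrib_left)
    next
      case False
      have \<pi>: "?\<pi> s = i" using False by (simp add: switching_policy_def d_def)
      have "0 \<le> \<Delta> * r i" using slot_pos rate_pos[OF i] by simp
      then have "bellman ?\<pi> W s = bellman ?\<pi> (static_time_bound i) s"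
        unfolding bellman_pos[of s ?\<pi> i, OF s \<pi>] using s False d by (simp add: small)
      then show ?thesis
        using bellman_static_time_bound[OF i s, of ?\<pi>, OF \<pi>] s False by (simp add: small)
    qed
  qed
qed

end

section \<open>The gain of dynamic over static channel selection\<close>

theorem corollary4p3:
  fixes N k istar :: nat
    and \<Delta> F :: real
    and r p m \<alpha> :: "nat \<Rightarrow> real"
    and M :: "'w measure"
    and X :: "nat \<Rightarrow> nat \<Rightarrow> 'w \<Rightarrow> bool"
    and pistar :: "real \<Rightarrow> nat"
  assumes "N \<ge> 2"
    and "\<Delta> > 0"
    and "\<forall>i\<in>{1..N}. r i > 0"
    and "\<forall>i\<in>{1..N}. 0 < p i \<and> p i \<le> 1"
    and "prob_space M"
    and "prob_space.indep_vars M (\<lambda>_. count_space UNIV) (\<lambda>(n, i). X n i) (UNIV \<times> {1..N})"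
    and "\<forall>n. \<forall>i\<in>{1..N}. measure M {\<omega> \<in> space M. X n i \<omega>} = p i"
    and "istar \<in> {1..N}"
    and "\<forall>i\<in>{1..N} - {istar}. r i * p i < r istar * p istar"
    and "p istar < 1"
    and "\<forall>i\<in>{1..N}. \<alpha> i = F / (\<Delta> * r i) - of_int \<lfloor>F / (\<Delta> * r i)\<rfloor>"
    and "\<forall>i\<in>{1..N} - {istar}. m i = p i / p istar"
    and "F \<in> {real k * \<Delta> * r istar <..< (real k + 1) * \<Delta> * r istar}"
    and "is_optimal_policy N M \<Delta> r X F pistar"
  shows
    "F / (F + \<Delta> * of_bool (\<alpha> istar > 0) * (1 - p istar) * r istar)
       \<le> enn2real (expected_time M \<Delta> r X pistar F)
           / enn2real (expected_time M \<Delta> r X (\<lambda>_. istar) F)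
     \<and>
     enn2real (expected_time M \<Delta> r X pistar F)
           / enn2real (expected_time M \<Delta> r X (\<lambda>_. istar) F)
       \<le> Min (insert 1
            ((\<lambda>i. (F / (\<Delta> * r i) + 1 - p i
                     - real k * m i * ((r istar * p istar - r i * p i) / (r i * p i)))
                  / ((real k + 1) * (m i - p i)))
             ` ({1..N} - {istar})))"
proof -
  interpret prob_space M by fact
  interpret slotted_channels M N \<Delta> r p X
    using assms by unfold_locales auto
  define A where "A = enn2real (expected_time M \<Delta> r X pistar F)"
  define B where "B = enn2real (expected_time M \<Delta> r X (\<lambda>_. istar) F)"
  have r: "0 < r istar" and p: "0 < p istar" "p istar < 1"
    using assms by auto
  have d: "0 < \<Delta> * r istar" using r \<open>\<Delta> > 0\<close> by simp
  have F_bounds: "real k * (\<Delta> * r istar) < F" "F < (real k + 1) * (\<Delta> * r istar)"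
    using assms(13) by (auto simp: mult.assoc)
  have x: "real k < F / (\<Delta> * r istar)" "F / (\<Delta> * r istar) < real k + 1"
    using F_bounds d by (simp_all add: pos_less_divide_eq pos_divide_less_eq)
  have floor: "\<lfloor>F / (\<Delta> * r istar)\<rfloor> = int k" and ceil: "\<lceil>F / (\<Delta> * r istar)\<rceil> = int k + 1"
    using x by linarith+
  have F: "0 < F" using F_bounds(1) d by (meson less_le_trans mult_nonneg_nonneg not_le of_nat_0_le_iff less_imp_le order_trans)
  have \<alpha>: "0 < \<alpha> istar"
    using assms(8,11) x floor by simp
  have pol: "pistar \<in> policies N"
    and opt: "\<And>\<pi>. \<pi> \<in> policies N \<Longrightarrow> expected_time M \<Delta> r X pistar F \<le> expected_time M \<Delta> r X \<pi> F"
    using assms(14) by (auto simp: is_optimal_policy_def is_arg_min_def not_less)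
  define E where "E = (real k + 1) * (\<Delta> * (1 - p istar) / p istar)"
  have E: "0 < E" using p \<open>\<Delta> > 0\<close> by (simp add: E_def)
  have static: "expected_time M \<Delta> r X (\<lambda>_. istar) F = ennreal (F / r istar + E)"
    using expected_time_static[of istar F] assms(8) p F by (simp add: static_time_def ceil E_def)
  have B: "B = F / r istar + E"
    unfolding B_def static using F r E by (intro enn2real_ennreal) simp
  have B_pos: "0 < B" using F r E by (simp add: B add_pos_pos)
  have static_pol: "(\<lambda>_. istar) \<in> policies N" using assms(8) by (simp add: policies_def)
  have A_le: "A \<le> b" if "expected_time M \<Delta> r X \<pi> F \<le> ennreal b" "\<pi> \<in> policies N" "0 \<le> b" for \<pi> b
    using order_trans[OF opt[OF that(2)] that(1)] that(3) unfolding A_def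
    by (metis enn2real_ennreal enn2real_mono ennreal_less_top)
  have A_le_B: "A \<le> B"
    using A_le[OF _ static_pol, of B] B B_pos static by simp
  have max: "r i * p i \<le> r istar * p istar" if "i \<in> {1..N}" for i
    using assms(9) that by (cases "i = istar") (auto intro: less_imp_le)
  have le_A: "F / (r istar * p istar) \<le> A"
  proof -
    have "expected_time M \<Delta> r X pistar F = ennreal A"
      using opt[OF static_pol] unfolding A_def static
      by (metis ennreal_enn2real ennreal_less_top le_less_trans)
    moreover have "0 \<le> A" by (simp add: A_def)
    ultimately show ?thesis
      using throughput_bound_le_expected_time[OF assms(8) max pol, of F] F
      by (metis ennreal_le_iff less_imp_le)
  qed
  have lower: "F / (F + \<Delta> * of_bool (\<alpha> istar > 0) * (1 - p istar) * r istar) \<le> A / B"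
  proof -
    define C where "C = F + \<Delta> * (1 - p istar) * r istar"
    have C: "0 < C" using F r p \<open>\<Delta> > 0\<close> by (simp add: C_def add_pos_pos)
    have "real k * (\<Delta> * r istar) * (1 - p istar) \<le> F * (1 - p istar)"
      using F_bounds(1) p by (intro mult_right_mono) auto
    moreover have "B * (r istar * p istar) =
        F * p istar + (real k + 1) * (\<Delta> * (1 - p istar) * r istar)"
      using r p by (simp add: B E_def field_simps)
    ultimately have "B * (r istar * p istar) \<le> C"
      by (simp add: C_def algebra_simps)
    then have "F / C \<le> F / (B * (r istar * p istar))"
      using F C B_pos r p by (intro divide_left_mono) auto
    also have "\<dots> = F / (r istar * p istar) / B" by simp
    also have "\<dots> \<le> A / B" using le_A B_pos by (intro divide_right_mono) auto
    finally show ?thesis using \<alpha> by (simp add: C_def)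
  qed
  have upper: "A / B \<le> (F / (\<Delta> * r i) + 1 - p i
        - real k * m i * ((r istar * p istar - r i * p i) / (r i * p i))) / ((real k + 1) * (m i - p i))"
    if i: "i \<in> {1..N} - {istar}" for i
  proof -
    have ri: "0 < r i" and pi: "0 < p i" "p i \<le> 1" and mi: "m i = p i / p istar"
      using assms i by auto
    define G where "G = real k * (\<Delta> / p istar) +
      ((F - real k * (\<Delta> * r istar)) / (r i * p i) + \<Delta> * (1 - p i) / p i)"
    have rest: "\<Delta> * r istar * frac (F / (\<Delta> * r istar)) = F - real k * (\<Delta> * r istar)"
      using r \<open>\<Delta> > 0\<close> by (simp add: frac_def floor field_simps)
    have G: "0 \<le> G"
      unfolding G_def using F_bounds p pi ri \<open>\<Delta> > 0\<close> by (intro add_nonneg_nonneg) auto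
    have "A \<le> G"
      using expected_time_switching_le[of istar i F] assms(8) i F F_bounds(1)
      by (intro A_le[OF _ _ G, of "switching_policy istar i"])
        (auto simp: policies_def switching_policy_def rest floor G_def static_time_bound_def)
    then have "A / B \<le> G / E"
      using G E F r by (intro frac_le) (auto simp: B)
    also have "G / E = (G * (p i / \<Delta>)) / (E * (p i / \<Delta>))"
      using pi \<open>\<Delta> > 0\<close> by simp
    also have "G * (p i / \<Delta>) = F / (\<Delta> * r i) + 1 - p i
        - real k * m i * ((r istar * p istar - r i * p i) / (r i * p i))"
      unfolding G_def mi using p pi ri r \<open>\<Delta> > 0\<close> by (simp add: field_simps)
    also have "E * (p i / \<Delta>) = (real k + 1) * (m i - p i)"
      unfolding E_def mi using p \<open>\<Delta> > 0\<close> by (simp add: field_simps)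
    finally show ?thesis .
  qed
  show ?thesis
    unfolding A_def[symmetric] B_def[symmetric]
    using lower upper A_le_B B_pos by auto
qed

end
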